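(* Let $\mathcal X,\mathcal Y$ be finite-dimensional Euclidean spaces, let $A:\mathcal X\to\mathcal Y$ be a linear map with adjoint $A^*$, and let $\mathcal C\subseteq\mathcal Y$ be a nonempty closed convex set with $0\notin\mathcal C$. Suppose that $A^{-1}\mathcal C\neq\emptyset$. Then $$(A^{-1}\mathcal C)'=\operatorname{cl}(A^*\mathcal C'),$$ and both sets are nonempty.
   Context: The antipolar of a set $\mathcal D$ is $\mathcal D'=\{y\mid\langle y,x\rangle\ge1\ \forall x\in\mathcal D\}$. $A^{-1}\mathcal C$ is the preimage of $\mathcal C$ under $A$, and $A^*\mathcal C'$ is the image of $\mathcal C'$ under $A^*$. $\operatorname{cl}$ denotes closure. *)

theory Defs
  imports "HOL-Analysis.Analysis"
begin

definition antipolar :: "'a::real_inner set \<Rightarrow> 'a set" where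
  "antipolar D = {y. \<forall>x\<in>D. y \<bullet> x \<ge> 1}"

end

theory Submission
  imports Defs
begin

text \<open>
  A closed convex set that is stable under dilations by factors \<open>t \<ge> 1\<close> and has a nonempty antipolar
  equals its own bi-antipolar. For \<open>C\<close> closed and convex with \<open>0 \<notin> C\<close>, the set of all dilates
  \<open>t C\<close>, \<open>t \<ge> 1\<close>, is such a set, so it equals \<open>C''\<close>. The closure of \<open>A\<^sup>* C'\<close> is
  also such a set, and any \<open>x\<close> in its antipolar has \<open>A x \<in> C''\<close>, hence is a dilate of a point
  of \<open>A\<^sup>-\<^sup>1 C\<close>. Thus \<open>(A\<^sup>-\<^sup>1 C)' \<subseteq> (cl (A\<^sup>* C'))'' = cl (A\<^sup>* C')\<close>.
\<close>

lemma antipolar_iff: "y \<in> antipolar D \<longleftrightarrow> (\<forall>x\<in>D. y \<bullet> x \<ge> 1)"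
  by (simp add: antipolar_def)

lemma closed_antipolar: "closed (antipolar D)"
proof -
  have "antipolar D = (\<Inter>x\<in>D. {y. x \<bullet> y \<ge> 1})"
    by (auto simp: antipolar_def inner_commute)
  then show ?thesis
    by (auto intro: closed_halfspace_ge)
qed

lemma convex_antipolar: "convex (antipolar D)"
proof -
  have "antipolar D = (\<Inter>x\<in>D. {y. x \<bullet> y \<ge> 1})"
    by (auto simp: antipolar_def inner_commute)
  then show ?thesis
    by (auto intro: convex_INT convex_halfspace_ge)
qed

lemma scaleR_antipolar:
  assumes "y \<in> antipolar D" "t \<ge> 1"
  shows "t *\<^sub>R y \<in> antipolar D"
  unfolding antipolar_iff
proof
  fix x assume "x \<in> D"
  then have "1 \<le> y \<bullet> x" using assms(1) by (simp add: antipolar_iff)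
  with assms(2) have "1 * 1 \<le> t * (y \<bullet> x)" by (intro mult_mono) auto
  then show "1 \<le> t *\<^sub>R y \<bullet> x" by simp
qed

text \<open>Strict separation of \<open>C\<close> from 0 gives a normal \<open>a\<close> and a level
  \<open>b > 0\<close>; rescaling by \<open>1 / b\<close> moves the level to 1.\<close>

lemma antipolar_nonempty:
  fixes C :: "'a::euclidean_space set"
  assumes "convex C" "closed C" "0 \<notin> C"
  shows "antipolar C \<noteq> {}"
proof -
  obtain a b where "0 < b" "\<forall>x\<in>C. a \<bullet> x > b"
    using separating_hyperplane_closed_0[OF assms] by blast
  then have "(1 / b) *\<^sub>R a \<in> antipolar C"
    by (auto simp: antipolar_iff field_simps intro: less_imp_le)
  then show ?thesis by blast
qed

text \<open>A point \<open>z\<close> outside \<open>T\<close> is strictly separated from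
  \<open>T\<close> by some \<open>a\<close> at level \<open>b\<close>. If \<open>b > 0\<close>, then
  \<open>a / b\<close> lies in the antipolar and violates the condition on \<open>z\<close>. If
  \<open>b \<le> 0\<close>, then \<open>a\<close> is a recession direction of the antipolar along
  which the product with \<open>z\<close> decreases.\<close>

lemma biantipolar_subset:
  fixes T :: "'a::euclidean_space set"
  assumes "convex T" "closed T"
    and scale: "\<And>t x. t \<ge> 1 \<Longrightarrow> x \<in> T \<Longrightarrow> t *\<^sub>R x \<in> T"
    and "antipolar T \<noteq> {}"
  shows "antipolar (antipolar T) \<subseteq> T"
proof
  fix z assume z: "z \<in> antipolar (antipolar T)"
  show "z \<in> T"
  proof (rule ccontr)
    assume "z \<notin> T"
    then obtain a b where az: "a \<bullet> z < b" and aT: "\<forall>x\<in>T. a \<bullet> x > b"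
      using separating_hyperplane_closed_point[OF assms(1,2)] by blast
    show False
    proof (cases "b > 0")
      case True
      with aT have "(1 / b) *\<^sub>R a \<in> antipolar T"
        by (auto simp: antipolar_iff field_simps intro: less_imp_le)
      with z have "1 \<le> z \<bullet> ((1 / b) *\<^sub>R a)"
        unfolding antipolar_iff[of z] by blast
      with az True show False by (simp add: inner_commute field_simps)
    next
      case False
      have nonneg: "a \<bullet> x \<ge> 0" if "x \<in> T" for x
      proof (rule ccontr)
        assume "\<not> a \<bullet> x \<ge> 0"
        then have neg: "a \<bullet> x < 0" by simp
        \<comment> \<open>A negative value of \<open>a\<close> at \<open>x\<close> could be dilated
          down to the level \<open>b\<close> or below, which separation forbids; \<open>t\<close> is
          such a factor, kept at least 1.\<close>
        define t where "t = max 1 (b / (a \<bullet> x))"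
        have "a \<bullet> (t *\<^sub>R x) > b"
          using aT scale[OF _ that, of t] by (auto simp only: t_def max.cobounded1)
        moreover have "t * (a \<bullet> x) \<le> b / (a \<bullet> x) * (a \<bullet> x)"
          using neg by (intro mult_right_mono_neg) (auto simp: t_def)
        ultimately show False using neg by simp
      qed
      obtain y where y: "y \<in> antipolar T" using assms(4) by blast
      have neg: "z \<bullet> a < 0" using az False by (simp add: inner_commute)
      \<comment> \<open>The step length at which the product of \<open>z\<close> with
        \<open>y + n *\<^sub>R a\<close> vanishes.\<close>
      define n where "n = (z \<bullet> y) / - (z \<bullet> a)"
      have zy: "1 \<le> z \<bullet> y" using z y by (auto simp: antipolar_iff[of z])
      have "n \<ge> 0" using neg zy by (auto simp: n_def intro!: divide_nonneg_nonpos)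
      then have "y + n *\<^sub>R a \<in> antipolar T"
        using y nonneg by (force simp: antipolar_iff inner_add_left intro: add_increasing2)
      with z have "1 \<le> z \<bullet> (y + n *\<^sub>R a)" unfolding antipolar_iff[of z] by blast
      also have "\<dots> = 0" using neg by (simp add: inner_add_right inner_diff_right n_def)
      finally show False by simp
    qed
  qed
qed

definition dilates :: "'a::real_vector set \<Rightarrow> 'a set" where
  "dilates C = {t *\<^sub>R c | t c. t \<ge> 1 \<and> c \<in> C}"

lemma dilatesI: "t \<ge> 1 \<Longrightarrow> c \<in> C \<Longrightarrow> t *\<^sub>R c \<in> dilates C"
  by (auto simp: dilates_def)

lemma dilatesE:
  assumes "x \<in> dilates C"
  obtains t c where "t \<ge> 1" "c \<in> C" "x = t *\<^sub>R c"
  using assms by (auto simp: dilates_def)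

lemma scaleR_dilates:
  assumes "x \<in> dilates C" "s \<ge> 1"
  shows "s *\<^sub>R x \<in> dilates C"
proof -
  obtain t c where *: "t \<ge> 1" "c \<in> C" "x = t *\<^sub>R c" using assms(1) by (rule dilatesE)
  have "1 * 1 \<le> s * t" using * assms(2) by (intro mult_mono) auto
  then show ?thesis using * dilatesI[of "s * t" c C] by simp
qed

text \<open>With \<open>r = u * s + v * t\<close>, the combination of \<open>s *\<^sub>R c\<close>
  and \<open>t *\<^sub>R d\<close> is \<open>r\<close> times a convex combination of
  \<open>c\<close> and \<open>d\<close>.\<close>

lemma convex_dilates:
  assumes "convex C"
  shows "convex (dilates C)"
proof (rule convexI)
  fix x y and u v :: real
  assume "x \<in> dilates C" "y \<in> dilates C" and uv: "0 \<le> u" "0 \<le> v" "u + v = 1"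
  then obtain s c t d where
    sc: "s \<ge> 1" "c \<in> C" "x = s *\<^sub>R c" and td: "t \<ge> 1" "d \<in> C" "y = t *\<^sub>R d"
    by (metis dilatesE)
  define r where "r = u * s + v * t"
  have "u * 1 + v * 1 \<le> r"
    unfolding r_def using uv sc td by (intro add_mono mult_left_mono) auto
  then have r: "r \<ge> 1" using uv by simp
  have "(u * s / r) *\<^sub>R c + (v * t / r) *\<^sub>R d \<in> C"
    using assms sc td uv r
    by (intro convexD) (auto simp: r_def simp flip: add_divide_distrib)
  from dilatesI[OF r this] show "u *\<^sub>R x + v *\<^sub>R y \<in> dilates C"
    using r sc td by (simp add: scaleR_add_right)
qed

text \<open>For \<open>x\<^sub>n = t\<^sub>n c\<^sub>n\<close> converging, the factors \<open>s\<^sub>n = 1 / t\<^sub>n \<in> (0, 1]\<close> cannot tend to 0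
  along a subsequence, since then \<open>c\<^sub>n = s\<^sub>n x\<^sub>n\<close> would tend to \<open>0 \<notin> C\<close>.\<close>

lemma closed_dilates:
  fixes C :: "'a::real_normed_vector set"
  assumes "closed C" "0 \<notin> C"
  shows "closed (dilates C)"
  unfolding closed_sequential_limits
proof (intro allI impI)
  fix x l
  assume xl: "(\<forall>n. x n \<in> dilates C) \<and> x \<longlonglongrightarrow> l"
  have "\<exists>s. 0 < s \<and> s \<le> 1 \<and> s *\<^sub>R x n \<in> C" for n
  proof -
    obtain t c where "t \<ge> 1" "c \<in> C" "x n = t *\<^sub>R c" using xl dilatesE by metis
    then show ?thesis by (intro exI[of _ "1 / t"]) auto
  qed
  then obtain s :: "nat \<Rightarrow> real" where s: "\<And>n. 0 < s n" "\<And>n. s n \<le> 1" "\<And>n. s n *\<^sub>R x n \<in> C"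
    by metis
  have "\<forall>n. s n \<in> {0..1}" using s by (simp add: less_imp_le)
  then obtain r \<sigma> where r: "r \<in> {0..1}" "strict_mono \<sigma>" "(s \<circ> \<sigma>) \<longlonglongrightarrow> r"
    using compact_Icc[of "0::real" 1] unfolding compact_def by metis
  have "(\<lambda>n. (s \<circ> \<sigma>) n *\<^sub>R (x \<circ> \<sigma>) n) \<longlonglongrightarrow> r *\<^sub>R l"
    using r(3) LIMSEQ_subseq_LIMSEQ[OF conjunct2[OF xl] r(2)] by (rule tendsto_scaleR)
  then have rl: "r *\<^sub>R l \<in> C"
    by (rule closed_sequentially[OF assms(1), rotated]) (simp add: s(3))
  with assms(2) have "r \<noteq> 0" by auto
  with r have "1 / r \<ge> 1" by simp
  from dilatesI[OF this rl] show "l \<in> dilates C" using \<open>r \<noteq> 0\<close> by simp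
qed

lemma antipolar_dilates: "antipolar (dilates C) = antipolar C"
proof
  show "antipolar (dilates C) \<subseteq> antipolar C"
    using dilatesI[of 1 _ C] by (force simp: antipolar_iff)
  show "antipolar C \<subseteq> antipolar (dilates C)"
  proof
    fix y assume y: "y \<in> antipolar C"
    show "y \<in> antipolar (dilates C)"
      unfolding antipolar_iff
    proof
      fix x assume "x \<in> dilates C"
      then obtain t c where "t \<ge> 1" "c \<in> C" "x = t *\<^sub>R c" by (rule dilatesE)
      then show "1 \<le> y \<bullet> x"
        using scaleR_antipolar[OF y, of t] by (auto simp: antipolar_iff)
    qed
  qed
qed

text \<open>Passing from \<open>C\<close> to its dilates leaves the antipolar unchanged and supplies
  the stability under scaling that \<open>biantipolar_subset\<close> demands.\<close>

lemma biantipolar_subset_dilates: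
  fixes C :: "'a::euclidean_space set"
  assumes "convex C" "closed C" "0 \<notin> C"
  shows "antipolar (antipolar C) \<subseteq> dilates C"
  using biantipolar_subset[of "dilates C"] assms antipolar_nonempty[of C]
  by (simp add: convex_dilates closed_dilates scaleR_dilates antipolar_dilates)

theorem proposition3p4:
  fixes A :: "'a::euclidean_space \<Rightarrow> 'b::euclidean_space"
    and C :: "'b set"
  assumes "linear A"
    and "C \<noteq> {}" and "closed C" and "convex C" and "0 \<notin> C"
    and "A -` C \<noteq> {}"
  shows "antipolar (A -` C) = closure (adjoint A ` antipolar C)
    \<and> antipolar (A -` C) \<noteq> {}
    \<and> closure (adjoint A ` antipolar C) \<noteq> {}"
proof -
  define K where "K = adjoint A ` antipolar C"
  have lin: "linear (adjoint A)" by (rule adjoint_linear) fact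
  have adj: "adjoint A y \<bullet> x = y \<bullet> A x" for x y
    by (rule adjoint_clauses) fact
  have "K \<subseteq> antipolar (A -` C)"
    by (auto simp: K_def antipolar_iff adj)
  then have sub: "closure K \<subseteq> antipolar (A -` C)"
    by (rule closure_minimal) (rule closed_antipolar)
  have scale: "t *\<^sub>R k \<in> closure K" if "t \<ge> 1" "k \<in> closure K" for t k
  proof -
    have "(*\<^sub>R) t ` K \<subseteq> K"
      using that(1) by (auto simp: K_def scaleR_antipolar simp flip: linear_scale[OF lin])
    then have "(*\<^sub>R) t ` closure K \<subseteq> closure K"
      by (simp add: closure_scaleR closure_mono)
    with that(2) show ?thesis by blast
  qed
  \<comment> \<open>By \<open>sub\<close> and the symmetry of the inner product, every point of the
    preimage of \<open>C\<close> belongs to this antipolar.\<close>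
  have "antipolar (closure K) \<noteq> {}"
  proof -
    obtain x where "x \<in> A -` C" using assms(6) by blast
    then have "x \<in> antipolar (closure K)"
      using sub by (auto simp: antipolar_iff inner_commute)
    then show ?thesis by blast
  qed
  moreover have "convex (closure K)"
    unfolding K_def by (intro convex_closure convex_linear_image lin convex_antipolar)
  ultimately have bi: "antipolar (antipolar (closure K)) \<subseteq> closure K"
    using scale by (intro biantipolar_subset) auto
  have "antipolar (A -` C) \<subseteq> antipolar (antipolar (closure K))"
  proof
    fix z assume z: "z \<in> antipolar (A -` C)"
    show "z \<in> antipolar (antipolar (closure K))"
      unfolding antipolar_iff[of z]
    proof
      fix x assume x: "x \<in> antipolar (closure K)"
      have "1 \<le> A x \<bullet> y" if "y \<in> antipolar C" for y
      proof -
        have "adjoint A y \<in> closure K"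
          using that closure_subset[of K] by (auto simp: K_def)
        with x show ?thesis by (metis antipolar_iff adj inner_commute)
      qed
      \<comment> \<open>The bound just shown places \<open>A x\<close> in the bi-antipolar of
        \<open>C\<close>. Dividing by the dilation factor then moves \<open>x\<close> into the
        preimage, and multiplying back by \<open>t \<ge> 1\<close> keeps the product with
        \<open>z\<close> at least 1.\<close>
      then have "A x \<in> dilates C"
        using biantipolar_subset_dilates[OF assms(4,3,5)] by (meson antipolar_iff subsetD)
      then obtain t c where t: "t \<ge> 1" and c: "c \<in> C" "A x = t *\<^sub>R c" by (rule dilatesE)
      then have "(1 / t) *\<^sub>R x \<in> A -` C"
        by (simp add: linear_scale[OF assms(1)])
      with z have "1 \<le> z \<bullet> ((1 / t) *\<^sub>R x)" by (metis antipolar_iff)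
      with t show "1 \<le> z \<bullet> x" by (simp add: field_simps)
    qed
  qed
  with bi sub have eq: "antipolar (A -` C) = closure K" by blast
  have "closure K \<noteq> {}"
    using antipolar_nonempty[of C] assms by (simp add: K_def)
  with eq show ?thesis by (simp add: K_def)
qed

end
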